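(* Let $\epsilon>0$ be a constant. Consider the following algorithm for streaming maximum-weight $b$-matching: run the MSbM Algorithm (described in the context) with $f=w$ (the linear weight function), $C=1+\epsilon/2$ and $q=1$, up to (but not including) its post-processing stage, and then compute a maximum-weight $b$-matching $M$ of the subgraph with edge set $S$ (the stack contents) using a polynomial-time linear-space offline algorithm. This is a streaming algorithm (using $\tilde O(\sum_v b_v)$ space) and it is $(3+\epsilon)$-approximate: $w(M)\ge\frac{1}{3+\epsilon}w(OPT)$, where $OPT$ is a maximum-weight $b$-matching of $G$.
   Context: Let $G=(V,E)$ be an $n$-vertex graph with degree bounds $b\in\mathbb{Z}_{>0}^V$ and non-negative edge weights $w:E\to\mathbb{R}_{\ge0}$ with $\max_e w_e/\min\{w_e: w_e>0\}=n^{O(1)}$; $w(T)=\sum_{e\in T}w_e$. A $b$-matching is a set of edges in which each vertex $v$ has degree at most $b_v$. Edges arrive in a stream $e^{(1)},\dots,e^{(|E|)}$; write $e<e'$ if $e$ arrives before $e'$. For a set function $f$, $f_S(e)=f(S\cup\{e\})-f(S)$ and $f(e:S)=f_{S\cap\{e'<e\}}(e)$. MSbM Algorithm with parameters $C>0$, $q\in[0,1]$: Initialize an empty stack $S$ and potentials $\phi_v^{(0)}=0$. For $t=1,\dots,|E|$: let $e=e^{(t)}$ and set $\phi^{(t)}_v=\phi^{(t-1)}_v$ for all $v$. If $C\sum_{v\in e}\phi^{(t-1)}_v\ge f(e:S)$, skip $e$. Otherwise, with probability $q$, push $e$ onto $S$ and for each $v\in e$ set $w_{ev}=\big(f(e:S)-\sum_{u\in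 e}\phi^{(t-1)}_u\big)/b_v$ and $\phi^{(t)}_v=\phi^{(t-1)}_v+w_{ev}$. *)

theory Defs
  imports "HOL-Probability.Probability"
begin

definition simple_graph :: "'v set \<Rightarrow> 'v set set \<Rightarrow> bool" where
  "simple_graph V E \<longleftrightarrow> finite V \<and> V \<noteq> {} \<and> (\<forall>e\<in>E. e \<subseteq> V \<and> card e = 2)"

definition weight :: "('e \<Rightarrow> real) \<Rightarrow> 'e set \<Rightarrow> real" where
  "weight w T = (\<Sum>e\<in>T. w e)"

definition b_matching :: "'v set \<Rightarrow> 'v set set \<Rightarrow> ('v \<Rightarrow> nat) \<Rightarrow> 'v set set \<Rightarrow> bool" where
  "b_matching V E b T \<longleftrightarrow> T \<subseteq> E \<and> (\<forall>v\<in>V. card {e \<in> T. v \<in> e} \<le> b v)"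

definition max_weight_b_matching ::
  "'v set \<Rightarrow> 'v set set \<Rightarrow> ('v \<Rightarrow> nat) \<Rightarrow> ('v set \<Rightarrow> real) \<Rightarrow> 'v set set \<Rightarrow> bool" where
  "max_weight_b_matching V E b w M \<longleftrightarrow> is_arg_max (weight w) (b_matching V E b) M"

(* max_e w_e / min {w_e : w_e > 0} \<le> n^c; nothing is required if no weight is positive. *)
definition weight_ratio_le :: "'v set \<Rightarrow> 'v set set \<Rightarrow> ('v set \<Rightarrow> real) \<Rightarrow> real \<Rightarrow> bool" where
  "weight_ratio_le V E w c \<longleftrightarrow>
     ((\<exists>e\<in>E. w e > 0) \<longrightarrow>
        Max (w ` E) / Min {w e | e. e \<in> E \<and> w e > 0} \<le> real (card V) powr c)"

definition wbm_instance ::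
  "real \<Rightarrow> 'v set \<Rightarrow> 'v set set \<Rightarrow> ('v \<Rightarrow> nat) \<Rightarrow> ('v set \<Rightarrow> real) \<Rightarrow> 'v set list \<Rightarrow> bool" where
  "wbm_instance c V E b w es \<longleftrightarrow>
     simple_graph V E \<and> (\<forall>v\<in>V. b v > 0) \<and> (\<forall>e\<in>E. w e \<ge> 0) \<and> weight_ratio_le V E w c \<and>
     distinct es \<and> set es = E"


section \<open>The MSbM algorithm\<close>

definition arrives_before :: "'e list \<Rightarrow> 'e \<Rightarrow> 'e \<Rightarrow> bool" where
  "arrives_before es e' e \<longleftrightarrow> (\<exists>i j. i < j \<and> j < length es \<and> es ! i = e' \<and> es ! j = e)"

definition marginal :: "('e set \<Rightarrow> real) \<Rightarrow> 'e set \<Rightarrow> 'e \<Rightarrow> real" where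
  "marginal f S e = f (S \<union> {e}) - f S"

(* f(e : S), where the arrival order is that of the list es. *)
definition marginal_before :: "('e set \<Rightarrow> real) \<Rightarrow> 'e list \<Rightarrow> 'e \<Rightarrow> 'e set \<Rightarrow> real" where
  "marginal_before f es e S = marginal f (S \<inter> {e'. arrives_before es e' e}) e"

(* A state is (stack, potentials), the head of the list being the top of the stack. *)
definition msbm_step ::
  "('v set set \<Rightarrow> real) \<Rightarrow> ('v \<Rightarrow> nat) \<Rightarrow> real \<Rightarrow> real \<Rightarrow> 'v set list \<Rightarrow> 'v set \<Rightarrow>
   'v set list \<times> ('v \<Rightarrow> real) \<Rightarrow> ('v set list \<times> ('v \<Rightarrow> real)) pmf" where
  "msbm_step f b C q es e = (\<lambda>(S, \<phi>).
     if C * (\<Sum>v\<in>e. \<phi> v) \<ge> marginal_before f es e (set S) then return_pmf (S, \<phi>)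
     else map_pmf (\<lambda>push.
            if push
            then (e # S,
                  \<lambda>v. if v \<in> e
                      then \<phi> v + (marginal_before f es e (set S) - (\<Sum>u\<in>e. \<phi> u)) / real (b v)
                      else \<phi> v)
            else (S, \<phi>))
          (bernoulli_pmf q))"

(* Distribution of the state after the first t edges of the stream es. *)
primrec msbm ::
  "('v set set \<Rightarrow> real) \<Rightarrow> ('v \<Rightarrow> nat) \<Rightarrow> real \<Rightarrow> real \<Rightarrow> 'v set list \<Rightarrow> nat \<Rightarrow>
   ('v set list \<times> ('v \<Rightarrow> real)) pmf" where
  "msbm f b C q es 0 = return_pmf ([], \<lambda>_. 0)"
| "msbm f b C q es (Suc t) = bind_pmf (msbm f b C q es t) (msbm_step f b C q es (es ! t))"


section \<open>Offline and streaming computation\<close>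

text \<open>
  Space is counted in machine words; a word holds a vertex name or a number (a weight, degree
  bound or potential). An offline computation is a transition system with a word count for
  each configuration; its steps and its word count are left arbitrary, so that statements
  quantifying over all machines do not depend on a particular instruction set.
\<close>

record ('c, 'o) machine =
  m_step :: "'c \<Rightarrow> 'c"
  m_halted :: "'c \<Rightarrow> bool"
  m_result :: "'c \<Rightarrow> 'o"
  m_words :: "'c \<Rightarrow> nat"

definition config :: "('c, 'o) machine \<Rightarrow> 'c \<Rightarrow> nat \<Rightarrow> 'c" where
  "config A c i = (m_step A ^^ i) c"

definition halts :: "('c, 'o) machine \<Rightarrow> 'c \<Rightarrow> bool" where
  "halts A c \<longleftrightarrow> (\<exists>i. m_halted A (config A c i))"

definition run_time :: "('c, 'o) machine \<Rightarrow> 'c \<Rightarrow> nat" where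
  "run_time A c = (LEAST i. m_halted A (config A c i))"

definition machine_output :: "('c, 'o) machine \<Rightarrow> 'c \<Rightarrow> 'o" where
  "machine_output A c = m_result A (config A c (run_time A c))"

text \<open>
  An offline algorithm receives the vertex set, the degree bounds and a list of weighted edges.
\<close>

record ('v, 'c) offline_alg =
  off_load :: "'v set \<Rightarrow> ('v \<Rightarrow> nat) \<Rightarrow> ('v set \<times> real) list \<Rightarrow> 'c"
  off_machine :: "('c, 'v set set) machine"

definition listed_weight :: "('e \<times> real) list \<Rightarrow> 'e \<Rightarrow> real" where
  "listed_weight L e = the (map_of L e)"

definition offline_input :: "'v set \<Rightarrow> ('v \<Rightarrow> nat) \<Rightarrow> ('v set \<times> real) list \<Rightarrow> bool" where
  "offline_input V b L \<longleftrightarrow>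
     simple_graph V (fst ` set L) \<and> distinct (map fst L) \<and>
     (\<forall>v\<in>V. b v > 0) \<and> (\<forall>(e, x) \<in> set L. x \<ge> 0)"

definition offline_correct :: "('v, 'c) offline_alg \<Rightarrow> bool" where
  "offline_correct A \<longleftrightarrow> (\<forall>V b L. offline_input V b L \<longrightarrow>
     halts (off_machine A) (off_load A V b L) \<and>
     max_weight_b_matching V (fst ` set L) b (listed_weight L)
       (machine_output (off_machine A) (off_load A V b L)))"

definition offline_polynomial_time :: "('v, 'c) offline_alg \<Rightarrow> bool" where
  "offline_polynomial_time A \<longleftrightarrow> (\<exists>K k. \<forall>V b L. offline_input V b L \<longrightarrow>
     run_time (off_machine A) (off_load A V b L) \<le> K * (card V + length L) ^ k)"

definition offline_linear_space :: "('v, 'c) offline_alg \<Rightarrow> bool" where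
  "offline_linear_space A \<longleftrightarrow> (\<exists>K. \<forall>V b L. offline_input V b L \<longrightarrow>
     (\<forall>i \<le> run_time (off_machine A) (off_load A V b L).
        m_words (off_machine A) (config (off_machine A) (off_load A V b L) i)
          \<le> K * (card V + length L)))"

text \<open>
  A one-pass streaming algorithm: the update sees only the arriving item and the memory, and
  after the stream has ended a machine is started on the final memory.
\<close>

record ('i, 'm, 'c, 'o) streaming_alg =
  s_init :: 'm
  s_update :: "'i \<Rightarrow> 'm \<Rightarrow> 'm pmf"
  s_words :: "'m \<Rightarrow> nat"
  s_load :: "'m \<Rightarrow> 'c"
  s_post :: "('c, 'o) machine"

primrec stream_memory :: "('i, 'm, 'c, 'o) streaming_alg \<Rightarrow> 'i list \<Rightarrow> nat \<Rightarrow> 'm pmf" where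
  "stream_memory A xs 0 = return_pmf (s_init A)"
| "stream_memory A xs (Suc t) = bind_pmf (stream_memory A xs t) (s_update A (xs ! t))"

definition stream_output :: "('i, 'm, 'c, 'o) streaming_alg \<Rightarrow> 'i list \<Rightarrow> 'o pmf" where
  "stream_output A xs =
     map_pmf (\<lambda>m. machine_output (s_post A) (s_load A m)) (stream_memory A xs (length xs))"

(* Worst case over time and over random choices; the final memory is kept while the
   post-processing machine runs. *)
definition stream_space_le ::
  "('i, 'm, 'c, 'o) streaming_alg \<Rightarrow> 'i list \<Rightarrow> real \<Rightarrow> bool" where
  "stream_space_le A xs B \<longleftrightarrow>
     (\<forall>t \<le> length xs. \<forall>m \<in> set_pmf (stream_memory A xs t). real (s_words A m) \<le> B) \<and>
     (\<forall>m \<in> set_pmf (stream_memory A xs (length xs)).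
        \<forall>i \<le> run_time (s_post A) (s_load A m).
          real (s_words A m + m_words (s_post A) (config (s_post A) (s_load A m) i)) \<le> B)"


section \<open>Streaming maximum-weight b-matching\<close>

text \<open>
  The MSbM stage with linear \<open>f\<close>, followed by an offline algorithm on the stack. Items are
  edges with their weights. The memory is the stack, whose edges carry their weights, together
  with the potentials; hence \<open>f\<close> and the arrival order are only available on the stack and the
  arriving edge. Words: two endpoints and a weight for each stacked edge and for the arriving
  edge; name, degree bound and potential for each vertex.
\<close>

definition wbm_streaming ::
  "real \<Rightarrow> real \<Rightarrow> ('v, 'c) offline_alg \<Rightarrow> 'v set \<Rightarrow> ('v \<Rightarrow> nat) \<Rightarrow>
   ('v set \<times> real, ('v set \<times> real) list \<times> ('v \<Rightarrow> real), 'c, 'v set set) streaming_alg" where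
  "wbm_streaming C q A V b =
     \<lparr> s_init = ([], \<lambda>_. 0),
       s_update = (\<lambda>(e, x) (L, \<phi>).
         let w = listed_weight ((e, x) # L); S = map fst L in
         map_pmf (\<lambda>(S', \<phi>'). (map (\<lambda>e'. (e', w e')) S', \<phi>'))
           (msbm_step (weight w) b C q (rev S @ [e]) e (S, \<phi>))),
       s_words = (\<lambda>(L, \<phi>). 3 * (length L + 1) + 3 * card V),
       s_load = (\<lambda>(L, \<phi>). off_load A V b L),
       s_post = off_machine A \<rparr>"

end

theory Submission
  imports Defs
begin

text \<open>
  Approximation: a skipped edge has weight at most \<open>C\<close> times the potentials of its endpoints, so
  an optimum \<open>OPT\<close> satisfies \<open>w (OPT - S) \<le> C * (\<Sum>v. b v * \<phi> v)\<close>. Unwinding the stack greedily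
  gives a \<open>b\<close>-matching inside \<open>S\<close> of weight at least half of \<open>\<Sum>v. b v * \<phi> v\<close>. As \<open>M\<close> is optimal
  in \<open>S\<close>, it dominates both this matching and \<open>OPT \<inter> S\<close>, hence
  \<open>w OPT \<le> (1 + 2 * C) * w M = (3 + \<epsilon>) * w M\<close>.

  Space: each push at \<open>v\<close> multiplies \<open>\<phi> v\<close> by at least \<open>1 + (C - 1) / b v\<close>, while \<open>\<phi> v\<close> stays
  below the maximum weight, so \<open>v\<close> receives \<open>O(b v * ln (b v * n powr c))\<close> pushes. If \<open>b v\<close>
  exceeds \<open>n\<close>, the trivial degree bound \<open>n\<close> is used instead, which removes \<open>ln (b v)\<close>.
\<close>

section \<open>Auxiliary facts: incidence counting, logarithms, linear weights\<close>

text \<open>Double counting of vertex-edge incidences. It is applied with the potentials to charge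
  an optimum, and with the constant 1 to bound the stack by its vertex degrees.\<close>

lemma sum_incidences:
  assumes "finite V" "finite T" "\<And>e. e \<in> T \<Longrightarrow> e \<subseteq> V"
  shows "(\<Sum>e\<in>T. \<Sum>v\<in>e. g v) = (\<Sum>v\<in>V. real (card {e \<in> T. v \<in> e}) * g v)"
proof -
  have "(\<Sum>e\<in>T. \<Sum>v\<in>e. g v) = (\<Sum>e\<in>T. \<Sum>v\<in>{v\<in>V. v \<in> e}. g v)"
    using assms(3) by (intro sum.cong refl) (auto intro: sum.cong)
  also have "\<dots> = (\<Sum>v\<in>V. \<Sum>e\<in>{e\<in>T. v \<in> e}. g v)"
    using assms(1,2) by (intro sum.swap_restrict)
  finally show ?thesis by simp
qed

text \<open>An edge at \<open>v\<close> is determined by its other endpoint. This is the fallback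
  degree bound when \<open>b v\<close> exceeds the number of vertices.\<close>

lemma degree_le_card:
  assumes "finite V" "\<And>e. e \<in> T \<Longrightarrow> e \<subseteq> V \<and> card e = 2"
  shows "card {e \<in> T. v \<in> e} \<le> card V"
proof -
  have "{e \<in> T. v \<in> e} \<subseteq> (\<lambda>u. {v, u}) ` V"
  proof
    fix e assume "e \<in> {e \<in> T. v \<in> e}"
    then have e: "e \<subseteq> V" "card e = 2" "v \<in> e" using assms(2) by auto
    then obtain x y where "e = {x, y}" by (auto simp: card_2_iff)
    then show "e \<in> (\<lambda>u. {v, u}) ` V" using e by auto
  qed
  then show ?thesis
    by (meson assms(1) card_image_le card_mono finite_imageI le_trans)
qed

lemma ln_add_one_lower:
  assumes "(x::real) > 0"
  shows "x / (1 + x) \<le> ln (1 + x)"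
  using ln_le_minus_one[of "1 / (1 + x)"] assms by (simp add: ln_div field_simps)

text \<open>For a linear function the marginal of a new edge depends neither on the stack nor on the
  arrival order. Hence the streaming update may use the order it rebuilds from its own
  stack.\<close>

lemma marginal_before_weight:
  assumes "finite S" "e \<notin> S"
  shows "marginal_before (weight w) es e S = w e"
  using assms by (simp add: marginal_before_def marginal_def weight_def)

lemma weight_cong: "(\<And>e. e \<in> T \<Longrightarrow> w e = w' e) \<Longrightarrow> weight w T = weight w' T"
  by (simp add: weight_def)

lemma listed_weight_graph:
  assumes "e \<in> set S"
  shows "listed_weight (map (\<lambda>e. (e, w e)) S) e = w e"
  using assms by (simp add: listed_weight_def map_of_map_restrict)

lemma msbm_step_weight:
  assumes "e \<notin> set S"
  shows "msbm_step (weight w) b C 1 es e (S, \<phi>) = return_pmf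
    (if w e \<le> C * (\<Sum>v\<in>e. \<phi> v) then (S, \<phi>)
     else (e # S, \<lambda>v. if v \<in> e then \<phi> v + (w e - (\<Sum>u\<in>e. \<phi> u)) / real (b v) else \<phi> v))"
proof -
  have "bernoulli_pmf 1 = return_pmf True"
    by (rule pmf_eqI) (auto simp: pmf_return indicator_def split: bool.splits)
  then show ?thesis
    using assms by (simp add: msbm_step_def marginal_before_weight fun_eq_iff)
qed

section \<open>The stage before post-processing as a deterministic trace\<close>

locale msbm_linear =
  fixes V :: "'v set" and b :: "'v \<Rightarrow> nat" and w :: "'v set \<Rightarrow> real" and C :: real
  assumes finite_V: "finite V" and b_pos: "\<And>v. v \<in> V \<Longrightarrow> b v > 0" and C_gt_1: "C > 1"
begin

text \<open>At \<open>q = 1\<close> nothing is random, so a relation replaces the distributions and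
  allows rule induction along the stream. The freshness premise on \<open>e\<close> keeps the stack
  distinct.\<close>

inductive run :: "'v set list \<Rightarrow> 'v set list \<Rightarrow> ('v \<Rightarrow> real) \<Rightarrow> bool" where
  init: "run [] [] (\<lambda>_. 0)"
| skip: "run (es @ [e]) S \<phi>"
    if "run es S \<phi>" "e \<notin> set es" "e \<subseteq> V" "card e = 2" "w e \<le> C * (\<Sum>v\<in>e. \<phi> v)"
| push: "run (es @ [e]) (e # S)
      (\<lambda>v. if v \<in> e then \<phi> v + (w e - (\<Sum>u\<in>e. \<phi> u)) / real (b v) else \<phi> v)"
    if "run es S \<phi>" "e \<notin> set es" "e \<subseteq> V" "card e = 2" "w e > C * (\<Sum>v\<in>e. \<phi> v)"

lemma run_stack:
  assumes "run es S \<phi>"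
  shows "distinct S \<and> set S \<subseteq> set es \<and> (\<forall>e\<in>set es. e \<subseteq> V \<and> card e = 2)"
  using assms by induction auto

text \<open>One induction on \<open>t\<close> produces a common trace for the abstract algorithm and
  the streaming memory: both distributions are point masses on it.\<close>

lemma msbm_eq_run:
  assumes "distinct es" "\<And>e. e \<in> set es \<Longrightarrow> e \<subseteq> V \<and> card e = 2" "t \<le> length es"
  shows "\<exists>S \<phi>. run (take t es) S \<phi> \<and>
    msbm (weight w) b C 1 es t = return_pmf (S, \<phi>) \<and>
    stream_memory (wbm_streaming C 1 A V b) (map (\<lambda>e. (e, w e)) es) t =
      return_pmf (map (\<lambda>e. (e, w e)) S, \<phi>)"
  using assms(3)
proof (induction t)
  case 0
  then show ?case by (auto simp: wbm_streaming_def intro: run.init)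
next
  case (Suc t)
  let ?e = "es ! t"
  from Suc obtain S \<phi> where IH: "run (take t es) S \<phi>"
      "msbm (weight w) b C 1 es t = return_pmf (S, \<phi>)"
      "stream_memory (wbm_streaming C 1 A V b) (map (\<lambda>e. (e, w e)) es) t =
        return_pmf (map (\<lambda>e. (e, w e)) S, \<phi>)"
    by auto
  have t: "t < length es" using Suc.prems by simp
  have take: "take (Suc t) es = take t es @ [?e]" using t by (rule take_Suc_conv_app_nth)
  have notin: "?e \<notin> set (take t es)"
    using assms(1) t take by (metis distinct_append distinct_take not_distinct_conv_prefix)
  have e: "?e \<subseteq> V" "card ?e = 2" using assms(2) t by auto
  have eS: "?e \<notin> set S" using run_stack[OF IH(1)] notin by auto
  \<comment> \<open>These are the weights recoverable from memory. They agree with \<open>w\<close>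
    on the stack and the arriving edge, which is all that the update consults.\<close>
  define lw where "lw = listed_weight ((?e, w ?e) # map (\<lambda>e. (e, w e)) S)"
  have lw: "lw e = w e" if "e \<in> set (?e # S)" for e
    using listed_weight_graph[of e "?e # S" w] that by (simp add: lw_def)
  define S' \<phi>' where
    "S' = (if w ?e \<le> C * (\<Sum>v\<in>?e. \<phi> v) then S else ?e # S)" and
    "\<phi>' = (if w ?e \<le> C * (\<Sum>v\<in>?e. \<phi> v) then \<phi>
      else (\<lambda>v. if v \<in> ?e then \<phi> v + (w ?e - (\<Sum>u\<in>?e. \<phi> u)) / real (b v) else \<phi> v))"
  have "run (take (Suc t) es) S' \<phi>'"
    unfolding take S'_def \<phi>'_def
    using run.skip[OF IH(1) notin e] run.push[OF IH(1) notin e] by auto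
  moreover have "msbm (weight w) b C 1 es (Suc t) = return_pmf (S', \<phi>')"
    by (simp add: IH(2) bind_return_pmf msbm_step_weight[OF eS] S'_def \<phi>'_def)
  moreover have "stream_memory (wbm_streaming C 1 A V b) (map (\<lambda>e. (e, w e)) es) (Suc t) =
      return_pmf (map (\<lambda>e. (e, w e)) S', \<phi>')"
  proof -
    have "stream_memory (wbm_streaming C 1 A V b) (map (\<lambda>e. (e, w e)) es) (Suc t) =
      map_pmf (\<lambda>(S', \<phi>'). (map (\<lambda>e'. (e', lw e')) S', \<phi>'))
        (msbm_step (weight lw) b C 1 (rev S @ [?e]) ?e (S, \<phi>))"
      using t by (simp add: IH(3) bind_return_pmf lw_def)
        (simp add: wbm_streaming_def comp_def Let_def)
    also have "\<dots> = return_pmf (map (\<lambda>e. (e, w e)) S', \<phi>')"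
      using lw by (simp add: msbm_step_weight[OF eS] S'_def \<phi>'_def fun_eq_iff)
    finally show ?thesis .
  qed
  ultimately show ?case by blast
qed

section \<open>Growth of the potentials\<close>

lemma run_nonneg:
  assumes "run es S \<phi>"
  shows "\<phi> v \<ge> 0"
  using assms
proof (induction arbitrary: v)
  case (push es S \<phi> e)
  have "(\<Sum>u\<in>e. \<phi> u) \<ge> 0" using push.IH by (simp add: sum_nonneg)
  then have "(\<Sum>u\<in>e. \<phi> u) \<le> C * (\<Sum>u\<in>e. \<phi> u)"
    using C_gt_1 by (simp add: mult_le_cancel_right1)
  then show ?case using push by auto
qed auto

text \<open>The gap between the test factor \<open>C\<close> and 1 makes each pushed edge gain a
  fixed fraction, both of the potentials at its endpoints and of its own weight.\<close>

lemma push_residual: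
  assumes "run es S \<phi>" "w e > C * (\<Sum>v\<in>e. \<phi> v)"
  shows "w e - (\<Sum>v\<in>e. \<phi> v) > (C - 1) * (\<Sum>v\<in>e. \<phi> v)"
    and "w e - (\<Sum>v\<in>e. \<phi> v) \<ge> (1 - 1 / C) * w e"
    and "w e > 0" and "w e - (\<Sum>v\<in>e. \<phi> v) > 0"
proof -
  have s: "(\<Sum>v\<in>e. \<phi> v) \<ge> 0" using run_nonneg[OF assms(1)] by (simp add: sum_nonneg)
  show 1: "w e - (\<Sum>v\<in>e. \<phi> v) > (C - 1) * (\<Sum>v\<in>e. \<phi> v)"
    using assms(2) by (simp add: algebra_simps)
  show "w e - (\<Sum>v\<in>e. \<phi> v) \<ge> (1 - 1 / C) * w e"
    using assms(2) C_gt_1 by (simp add: field_simps)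
  have "C * (\<Sum>v\<in>e. \<phi> v) \<ge> 0" "(C - 1) * (\<Sum>v\<in>e. \<phi> v) \<ge> 0" using s C_gt_1 by simp_all
  then show "w e > 0" "w e - (\<Sum>v\<in>e. \<phi> v) > 0" using assms(2) 1 by linarith+
qed

text \<open>As \<open>b v \<ge> 1\<close>, a push raises \<open>\<phi> v\<close> by at most the full
  residual. Since \<open>\<phi> v\<close> is part of the sum subtracted in that residual, the new
  value is at most \<open>w e\<close>.\<close>

lemma run_upper:
  assumes "run es S \<phi>" "\<And>e. e \<in> set es \<Longrightarrow> w e \<le> W" "W \<ge> 0"
  shows "\<phi> v \<le> W"
  using assms
proof (induction arbitrary: v)
  case (push es S \<phi> e)
  show ?case
  proof (cases "v \<in> e")
    case True
    have fin: "finite e" using push.hyps(4) by (simp add: card_ge_0_finite)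
    let ?r = "w e - (\<Sum>u\<in>e. \<phi> u)"
    have "?r > 0" using push_residual[OF push.hyps(1,5)] by simp
    moreover have "real (b v) \<ge> 1" using b_pos push.hyps(3) True
      by (metis One_nat_def Suc_leI of_nat_1 of_nat_mono subsetD)
    ultimately have "?r / real (b v) \<le> ?r" by (simp add: divide_le_eq mult_le_cancel_left1)
    moreover have "\<phi> v \<le> (\<Sum>u\<in>e. \<phi> u)"
      using fin True run_nonneg[OF push.hyps(1)] by (simp add: member_le_sum)
    moreover have "w e \<le> W" using push.prems by simp
    ultimately show ?thesis using True by simp
  next
    case False
    then show ?thesis using push by simp
  qed
qed auto

text \<open>The first push at \<open>v\<close> contributes at least
  \<open>(1 - 1 / C) * m / b v\<close>. Each later one adds at least
  \<open>(C - 1) * \<phi> v / b v\<close>, because the residual exceeds \<open>(C - 1)\<close> times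
  the endpoint potentials. Hence the exponent is one less than the degree.\<close>

lemma run_growth:
  assumes "run es S \<phi>" "v \<in> V" "\<And>e. e \<in> set es \<Longrightarrow> w e > 0 \<Longrightarrow> m \<le> w e"
    "{e \<in> set S. v \<in> e} \<noteq> {}"
  shows "(1 - 1 / C) * m / real (b v) *
    (1 + (C - 1) / real (b v)) ^ (card {e \<in> set S. v \<in> e} - 1) \<le> \<phi> v"
  using assms
proof induction
  case (push es S \<phi> e)
  show ?case
  proof (cases "v \<in> e")
    case True
    have fin: "finite e" using push.hyps(4) by (simp add: card_ge_0_finite)
    let ?r = "w e - (\<Sum>u\<in>e. \<phi> u)" and ?D = "{e \<in> set S. v \<in> e}"
    have eS: "e \<notin> set S" using run_stack[OF push.hyps(1)] push.hyps(2) by auto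
    have card: "card {e' \<in> set (e # S). v \<in> e'} = Suc (card ?D)"
    proof -
      have "{e' \<in> set (e # S). v \<in> e'} = insert e ?D" using True by auto
      then show ?thesis using eS by simp
    qed
    have bv: "real (b v) > 0" using b_pos push.prems(1) by simp
    have nn: "\<phi> v \<ge> 0" using run_nonneg[OF push.hyps(1)] .
    show ?thesis
    proof (cases "?D = {}")
      case D: True
      have "m \<le> w e" using push.prems push_residual[OF push.hyps(1,5)] by simp
      then have "(1 - 1 / C) * m \<le> (1 - 1 / C) * w e" using C_gt_1 by (intro mult_left_mono) auto
      also have "\<dots> \<le> ?r" using push_residual[OF push.hyps(1,5)] by simp
      finally have "(1 - 1 / C) * m / real (b v) \<le> ?r / real (b v)"
        using bv by (simp add: divide_right_mono)
      moreover have "card ?D = 0" using D by (metis card.empty)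
      ultimately show ?thesis using True nn unfolding card by (simp del: Collect_empty_eq)
    next
      case False
      let ?x = "1 + (C - 1) / real (b v)"
      have IH: "(1 - 1 / C) * m / real (b v) * ?x ^ (card ?D - 1) \<le> \<phi> v"
        using push.IH push.prems False by simp
      have "finite ?D" by simp
      then have "card ?D > 0" using False card_gt_0_iff by blast
      then have "?x ^ card ?D = ?x ^ (card ?D - 1) * ?x"
        by (simp only: power_Suc2[symmetric] Suc_diff_1)
      then have "(1 - 1 / C) * m / real (b v) * ?x ^ card ?D
          = ((1 - 1 / C) * m / real (b v) * ?x ^ (card ?D - 1)) * ?x"
        by (simp only: mult.assoc)
      also have "\<dots> \<le> \<phi> v * ?x" using IH C_gt_1 bv by (intro mult_right_mono) auto
      also have "\<dots> = \<phi> v + (C - 1) * \<phi> v / real (b v)" by (simp add: algebra_simps)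
      also have "\<dots> \<le> \<phi> v + ?r / real (b v)"
      proof -
        have "\<phi> v \<le> (\<Sum>u\<in>e. \<phi> u)"
          using fin True run_nonneg[OF push.hyps(1)] by (simp add: member_le_sum)
        then have "(C - 1) * \<phi> v \<le> (C - 1) * (\<Sum>u\<in>e. \<phi> u)"
          using C_gt_1 by (intro mult_left_mono) auto
        also have "\<dots> \<le> ?r" using push_residual[OF push.hyps(1,5)] by simp
        finally show ?thesis using bv by (simp add: divide_right_mono)
      qed
      finally show ?thesis using True unfolding card by simp
    qed
  next
    case False
    then have "{e' \<in> set (e # S). v \<in> e'} = {e' \<in> set S. v \<in> e'}" by auto
    then show ?thesis using push False by auto
  qed
qed auto

section \<open>Approximation guarantee\<close>

text \<open>The inequality holds when \<open>e\<close> is rejected and survives to the end because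
  potentials never decrease.\<close>

lemma run_skipped:
  assumes "run es S \<phi>" "e \<in> set es" "e \<notin> set S"
  shows "w e \<le> C * (\<Sum>v\<in>e. \<phi> v)"
  using assms
proof induction
  case (push es S \<phi> e')
  have "w e \<le> C * (\<Sum>v\<in>e. \<phi> v)" using push by auto
  also have "\<dots> \<le> C * (\<Sum>v\<in>e. if v \<in> e'
      then \<phi> v + (w e' - (\<Sum>u\<in>e'. \<phi> u)) / real (b v) else \<phi> v)"
    using C_gt_1 push_residual[OF push.hyps(1,5)] by (intro mult_left_mono sum_mono) auto
  finally show ?case .
qed auto

text \<open>
  Popping the stack greedily produces the matching. The degree bounds \<open>b'\<close> are the capacities
  left over by the edges popped so far, and each unit of used capacity at \<open>v\<close> has already
  paid for the potential \<open>\<phi> v\<close>.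
\<close>

lemma run_greedy:
  assumes "run es S \<phi>" "\<And>v. v \<in> V \<Longrightarrow> b' v \<le> b v"
  shows "\<exists>N. b_matching V (set S) b' N \<and>
    (\<Sum>v\<in>V. real (b v) * \<phi> v) / 2 \<le> weight w N + (\<Sum>v\<in>V. real (b v - b' v) * \<phi> v)"
  using assms
proof (induction arbitrary: b')
  case init
  show ?case by (rule exI[of _ "{}"]) (simp add: b_matching_def weight_def)
next
  case (skip es S \<phi> e)
  then show ?case by blast
next
  case (push es S \<phi> e)
  let ?r = "w e - (\<Sum>u\<in>e. \<phi> u)"
  define \<phi>' where "\<phi>' = (\<lambda>v. if v \<in> e then \<phi> v + ?r / real (b v) else \<phi> v)"
  have fin: "finite e" using push.hyps(4) by (simp add: card_ge_0_finite)
  have r: "?r > 0" using push_residual[OF push.hyps(1,5)] by simp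
  have eS: "e \<notin> set S" using run_stack[OF push.hyps(1)] push.hyps(2) by auto
  have bp: "real (b v) > 0" if "v \<in> e" for v using b_pos push.hyps(3) that by auto
  have Ve: "V \<inter> e = e" using push.hyps(3) by auto
  have delta: "(\<Sum>v\<in>V. g v * \<phi>' v) = (\<Sum>v\<in>V. g v * \<phi> v) + (\<Sum>v\<in>e. g v * (?r / real (b v)))" for g
  proof -
    have "(\<Sum>v\<in>V. g v * \<phi>' v) = (\<Sum>v\<in>V. g v * \<phi> v + (if v \<in> e then g v * (?r / real (b v)) else 0))"
      by (intro sum.cong refl) (simp add: \<phi>'_def distrib_left)
    then show ?thesis using finite_V by (simp add: sum.distrib sum.inter_restrict[symmetric] Ve)
  qed
  have "(\<Sum>v\<in>e. real (b v) * (?r / real (b v))) = (\<Sum>v\<in>e. ?r)"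
    using bp by (intro sum.cong refl) fastforce
  \<comment> \<open>Each of the two endpoints contributes \<open>?r\<close>, the factor
    \<open>b v\<close> cancelling the division in the update; halving leaves a single
    \<open>?r\<close>.\<close>
  then have total: "(\<Sum>v\<in>V. real (b v) * \<phi>' v) / 2 = (\<Sum>v\<in>V. real (b v) * \<phi> v) / 2 + ?r"
    unfolding delta using push.hyps(4) by (simp add: field_simps)
  have "\<exists>N. b_matching V (set (e # S)) b' N \<and>
    (\<Sum>v\<in>V. real (b v) * \<phi>' v) / 2 \<le> weight w N + (\<Sum>v\<in>V. real (b v - b' v) * \<phi>' v)"
  proof (cases "\<exists>v\<in>e. b' v = 0")
    case True
    then obtain v where v: "v \<in> e" "b' v = 0" by blast
    from push.IH[OF push.prems] obtain N where N: "b_matching V (set S) b' N"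
      "(\<Sum>v\<in>V. real (b v) * \<phi> v) / 2 \<le> weight w N + (\<Sum>v\<in>V. real (b v - b' v) * \<phi> v)"
      by blast
    have "?r = real (b v - b' v) * (?r / real (b v))" using v bp by fastforce
    also have "\<dots> \<le> (\<Sum>v\<in>e. real (b v - b' v) * (?r / real (b v)))"
      using fin v(1) r by (intro member_le_sum[of v e "\<lambda>v. real (b v - b' v) * (?r / real (b v))"]) auto
    finally have "(\<Sum>v\<in>V. real (b v) * \<phi>' v) / 2 \<le>
        weight w N + (\<Sum>v\<in>V. real (b v - b' v) * \<phi>' v)"
      using N(2) unfolding total unfolding delta by linarith
    moreover have "b_matching V (set (e # S)) b' N" using N(1) by (auto simp: b_matching_def)
    ultimately show ?thesis by blast
  next
    case False
    \<comment> \<open>Here \<open>e\<close> is taken, which reserves one unit at each endpoint.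
      Neither capacity is zero, so the natural subtraction does not truncate.\<close>
    define b'' where "b'' = (\<lambda>v. if v \<in> e then b' v - 1 else b' v)"
    have "b'' v \<le> b v" if "v \<in> V" for v using push.prems[OF that] by (auto simp: b''_def)
    from push.IH[OF this] obtain N where N: "b_matching V (set S) b'' N"
      "(\<Sum>v\<in>V. real (b v) * \<phi> v) / 2 \<le> weight w N + (\<Sum>v\<in>V. real (b v - b'' v) * \<phi> v)"
      by blast
    have NS: "N \<subseteq> set S" using N(1) by (simp add: b_matching_def)
    then have finN: "finite N" and eN: "e \<notin> N" using eS finite_subset by auto
    have "b_matching V (set (e # S)) b' (insert e N)"
      unfolding b_matching_def
    proof (intro conjI ballI)
      show "insert e N \<subseteq> set (e # S)" using NS by auto
      fix v assume "v \<in> V"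
      then have *: "card {e \<in> N. v \<in> e} \<le> b'' v" using N(1) by (simp add: b_matching_def)
      show "card {e' \<in> insert e N. v \<in> e'} \<le> b' v"
      proof (cases "v \<in> e")
        case True
        then have "{e' \<in> insert e N. v \<in> e'} = insert e {e \<in> N. v \<in> e}" by auto
        then have "card {e' \<in> insert e N. v \<in> e'} = Suc (card {e \<in> N. v \<in> e})"
          using eN finN by simp
        moreover have "b' v \<noteq> 0" using True False by auto
        ultimately show ?thesis using * True by (simp add: b''_def)
      next
        case vne: False
        then have "{e' \<in> insert e N. v \<in> e'} = {e \<in> N. v \<in> e}" by auto
        then show ?thesis using * vne by (simp add: b''_def)
      qed
    qed
    moreover have "(\<Sum>v\<in>V. real (b v) * \<phi>' v) / 2 \<le>
        weight w (insert e N) + (\<Sum>v\<in>V. real (b v - b' v) * \<phi>' v)"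
    proof -
      have "(\<Sum>v\<in>V. real (b v - b'' v) * \<phi> v) =
          (\<Sum>v\<in>V. real (b v - b' v) * \<phi> v + (if v \<in> e then \<phi> v else 0))"
      proof (intro sum.cong refl)
        fix v assume v: "v \<in> V"
        have "real (b v - b'' v) = real (b v - b' v) + (if v \<in> e then 1 else 0)"
          using push.prems[OF v] False by (auto simp: b''_def of_nat_diff)
        then show "real (b v - b'' v) * \<phi> v =
            real (b v - b' v) * \<phi> v + (if v \<in> e then \<phi> v else 0)"
          by (simp add: distrib_right)
      qed
      also have "\<dots> = (\<Sum>v\<in>V. real (b v - b' v) * \<phi> v) + (\<Sum>v\<in>e. \<phi> v)"
        using finite_V by (simp add: sum.distrib sum.inter_restrict[symmetric] Ve)
      finally have 1: "(\<Sum>v\<in>V. real (b v - b'' v) * \<phi> v) =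
        (\<Sum>v\<in>V. real (b v - b' v) * \<phi> v) + (\<Sum>v\<in>e. \<phi> v)" .
      have 2: "weight w (insert e N) = w e + weight w N"
        using finN eN by (simp add: weight_def)
      have 3: "(\<Sum>v\<in>e. real (b v - b' v) * (?r / real (b v))) \<ge> 0"
        using r by (intro sum_nonneg) auto
      \<comment> \<open>The weight of \<open>e\<close> splits as \<open>?r\<close> plus the old
        potentials of its endpoints. The first part covers the growth of the left side, the second
        the two units by which \<open>b''\<close> lies below \<open>b'\<close>.\<close>
      show ?thesis using N(2) 3 unfolding total unfolding delta 1 2 by linarith
    qed
    ultimately show ?thesis by blast
  qed
  then show ?case unfolding \<phi>'_def .
qed

lemma run_approx:
  assumes run: "run es S \<phi>" and M: "max_weight_b_matching V (set S) b w M"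
    and T: "b_matching V (set es) b T"
  shows "weight w T \<le> (1 + 2 * C) * weight w M"
proof -
  have TE: "T \<subseteq> set es" and deg: "\<And>v. v \<in> V \<Longrightarrow> card {e \<in> T. v \<in> e} \<le> b v"
    using T by (auto simp: b_matching_def)
  then have finT: "finite T" using finite_subset by blast
  have Mmax: "weight w N \<le> weight w M" if "b_matching V (set S) b N" for N
    using M that by (auto simp: max_weight_b_matching_def is_arg_max_linorder)
  have "b_matching V (set S) b (T \<inter> set S)"
    unfolding b_matching_def
  proof (intro conjI ballI)
    fix v assume v: "v \<in> V"
    have "card {e \<in> T \<inter> set S. v \<in> e} \<le> card {e \<in> T. v \<in> e}"
      using finT by (intro card_mono) auto
    then show "card {e \<in> T \<inter> set S. v \<in> e} \<le> b v" using deg[OF v] by simp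
  qed auto
  then have stacked: "weight w (T \<inter> set S) \<le> weight w M" by (rule Mmax)
  \<comment> \<open>Starting from full capacities, the prepaid term \<open>b v - b v\<close>
    vanishes.\<close>
  from run_greedy[OF run, of b] obtain N where "b_matching V (set S) b N"
    "(\<Sum>v\<in>V. real (b v) * \<phi> v) / 2 \<le> weight w N" by auto
  then have dual: "(\<Sum>v\<in>V. real (b v) * \<phi> v) \<le> 2 * weight w M" using Mmax[of N] by linarith
  have nn: "\<phi> v \<ge> 0" for v using run_nonneg[OF run] .
  have "weight w (T - set S) \<le> (\<Sum>e\<in>T - set S. C * (\<Sum>v\<in>e. \<phi> v))"
    unfolding weight_def using TE run_skipped[OF run] by (intro sum_mono) auto
  also have "\<dots> \<le> (\<Sum>e\<in>T. C * (\<Sum>v\<in>e. \<phi> v))"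
    using finT C_gt_1 nn by (intro sum_mono2) (auto intro!: mult_nonneg_nonneg sum_nonneg)
  also have "\<dots> = C * (\<Sum>v\<in>V. real (card {e \<in> T. v \<in> e}) * \<phi> v)"
    using sum_incidences[OF finite_V finT, of \<phi>] TE run_stack[OF run]
    by (auto simp: sum_distrib_left[symmetric])
  also have "\<dots> \<le> C * (\<Sum>v\<in>V. real (b v) * \<phi> v)"
    using C_gt_1 deg nn by (intro mult_left_mono sum_mono mult_right_mono) auto
  also have "\<dots> \<le> C * (2 * weight w M)" using dual C_gt_1 by (intro mult_left_mono) auto
  finally have skipped: "weight w (T - set S) \<le> C * (2 * weight w M)" .
  have "weight w T = weight w (T \<inter> set S) + weight w (T - set S)"
    unfolding weight_def using finT by (metis sum.Int_Diff)
  then show ?thesis using stacked skipped by (simp add: algebra_simps)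
qed

section \<open>Bound on the stack size\<close>

text \<open>The leading \<open>1 / ln 2\<close> pays for the trivial degree bound, and otherwise for
  the first push at a vertex. The rest is the growth estimate: \<open>1\<close> for
  \<open>ln (b v)\<close>, \<open>\<bar>c\<bar>\<close> for the weight ratio, and the last summand
  for the constant \<open>ln (C / (C - 1))\<close>, each rescaled to a multiple of
  \<open>ln (n + 1)\<close>, where \<open>n\<close> is the number of vertices.\<close>

definition space_const :: "real \<Rightarrow> real" where
  "space_const c = 1 / ln 2 + C / (C - 1) * (1 + \<bar>c\<bar> + ln (C / (C - 1)) / ln 2)"

lemma space_const_ge: "space_const c \<ge> 1 / ln 2"
proof -
  have "C / (C - 1) \<ge> 1" using C_gt_1 by simp
  then have "C / (C - 1) * (1 + \<bar>c\<bar> + ln (C / (C - 1)) / ln 2) \<ge> 0"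
    by (intro mult_nonneg_nonneg add_nonneg_nonneg divide_nonneg_nonneg) (use C_gt_1 in auto)
  then show ?thesis unfolding space_const_def by linarith
qed

lemma space_const_nonneg: "space_const c \<ge> 0"
  by (rule order_trans[OF _ space_const_ge]) simp

text \<open>The geometric lower bound on \<open>\<phi> v\<close> must stay below the cap
  \<open>W\<close>; taking logarithms bounds the number of pushes at \<open>v\<close>.\<close>

lemma run_degree:
  assumes run: "run es S \<phi>" and v: "v \<in> V"
    and m: "m > 0" "\<And>e. e \<in> set es \<Longrightarrow> w e > 0 \<Longrightarrow> m \<le> w e"
    and W: "W > 0" "\<And>e. e \<in> set es \<Longrightarrow> w e \<le> W"
    and ratio: "W / m \<le> real (card V) powr c"
  shows "real (card {e \<in> set S. v \<in> e}) \<le> space_const c * real (b v) * ln (real (card V) + 1)"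
proof -
  let ?n = "real (card V)" and ?k = "card {e \<in> set S. v \<in> e}" and ?a = "real (b v)"
  let ?D = "C / (C - 1)"
  have n: "?n \<ge> 1" using v finite_V by (metis One_nat_def Suc_leI card_gt_0_iff empty_iff of_nat_1 of_nat_mono)
  have a: "?a \<ge> 1" using b_pos[OF v] by simp
  have ln2: "ln (2::real) > 0" by simp
  have lnn: "ln (?n + 1) \<ge> ln 2" using n by simp
  have D: "?D \<ge> 1" using C_gt_1 by simp
  have one: "1 \<le> 1 / ln 2 * ln (?n + 1)" using lnn ln2 by (simp add: field_simps)
  have pos: "ln (?n + 1) > 0" using lnn ln2 by linarith
  show ?thesis
  proof (cases "?a > ?n")
    case True
    have "?k \<le> card V"
      using degree_le_card[OF finite_V, of "set S" v] run_stack[OF run] by auto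
    then have "real ?k \<le> ?n" by simp
    also have "\<dots> \<le> ?a * 1" using True by simp
    also have "\<dots> \<le> ?a * (1 / ln 2 * ln (?n + 1))" using one a by (intro mult_left_mono) auto
    also have "\<dots> \<le> ?a * (space_const c * ln (?n + 1))"
      using space_const_ge pos a by (intro mult_left_mono mult_right_mono) auto
    finally show ?thesis by (simp add: mult_ac)
  next
    \<comment> \<open>Now \<open>b v\<close> is at most the number of vertices, so
      \<open>ln (b v)\<close> is absorbed into \<open>ln (?n + 1)\<close>.\<close>
    case False
    show ?thesis
    proof (cases "{e \<in> set S. v \<in> e} = {}")
      case True
      then have "?k = 0" by (metis card.empty)
      then show ?thesis using pos a space_const_nonneg by (simp del: Collect_empty_eq)
    next
      case nonempty: False
      let ?x = "(C - 1) / ?a"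
      have x: "?x > 0" using C_gt_1 a by simp
      have "(1 - 1 / C) * m / ?a * (1 + ?x) ^ (?k - 1) \<le> \<phi> v"
        using run_growth[OF run v m(2) nonempty] by simp
      also have "\<dots> \<le> W" using run_upper[OF run W(2)] W(1) by simp
      finally have "(1 + ?x) ^ (?k - 1) \<le> W / ((1 - 1 / C) * m / ?a)"
        using C_gt_1 m(1) a by (subst pos_le_divide_eq) (auto simp: mult_ac)
      also have "\<dots> = ?a * ?D * (W / m)"
        using C_gt_1 m(1) a by (simp add: field_simps)
      also have "\<dots> \<le> ?a * ?D * ?n powr c"
        using ratio a C_gt_1 by (intro mult_left_mono) auto
      finally have "ln ((1 + ?x) ^ (?k - 1)) \<le> ln (?a * ?D * ?n powr c)"
        using x by (intro ln_mono) auto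
      also have "\<dots> = ln ?a + ln ?D + c * ln ?n"
        using a D n C_gt_1 by (subst ln_mult_pos, simp, simp, subst ln_mult_pos) (auto simp: ln_powr)
      also have "\<dots> \<le> ln (?n + 1) + ln ?D / ln 2 * ln (?n + 1) + \<bar>c\<bar> * ln (?n + 1)"
      proof (intro add_mono)
        show "ln ?a \<le> ln (?n + 1)" using False a by (intro ln_mono) auto
        have "ln ?D * 1 \<le> ln ?D * (1 / ln 2 * ln (?n + 1))"
          using one D by (intro mult_left_mono) auto
        then show "ln ?D \<le> ln ?D / ln 2 * ln (?n + 1)" by simp
        have "c * ln ?n \<le> \<bar>c\<bar> * ln ?n" using n by (intro mult_right_mono) auto
        also have "\<dots> \<le> \<bar>c\<bar> * ln (?n + 1)" using n by (intro mult_left_mono) auto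
        finally show "c * ln ?n \<le> \<bar>c\<bar> * ln (?n + 1)" .
      qed
      finally have 1: "real (?k - 1) * ln (1 + ?x) \<le> (1 + \<bar>c\<bar> + ln ?D / ln 2) * ln (?n + 1)"
        using x by (simp add: ln_realpow algebra_simps)
      \<comment> \<open>Converts \<open>ln (1 + ?x)\<close> into order \<open>1 / b v\<close>, using
        \<open>?a + (C - 1) \<le> ?a * C\<close>, valid since \<open>?a \<ge> 1\<close>.\<close>
      have "1 / (?a * ?D) \<le> ?x / (1 + ?x)"
      proof -
        have "?x / (1 + ?x) = (C - 1) / (?a + (C - 1))"
          using a C_gt_1 by (simp add: add_divide_eq_iff)
        also have "\<dots> \<ge> (C - 1) / (?a * C)"
        proof (intro divide_left_mono)
          have "?a * (C - 1) \<ge> 1 * (C - 1)" using a C_gt_1 by (intro mult_right_mono) auto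
          then show "?a + (C - 1) \<le> ?a * C" by (simp add: algebra_simps)
        qed (use a C_gt_1 in auto)
        finally show ?thesis by (simp add: mult.commute)
      qed
      also have "\<dots> \<le> ln (1 + ?x)" by (rule ln_add_one_lower[OF x])
      finally have "real (?k - 1) * (1 / (?a * ?D)) \<le> real (?k - 1) * ln (1 + ?x)"
        by (intro mult_left_mono) auto
      with 1 have "real (?k - 1) / (?a * ?D) \<le> (1 + \<bar>c\<bar> + ln ?D / ln 2) * ln (?n + 1)" by simp
      then have "real (?k - 1) \<le> (1 + \<bar>c\<bar> + ln ?D / ln 2) * ln (?n + 1) * (?a * ?D)"
        using a C_gt_1 by (subst (asm) pos_divide_le_eq) auto
      \<comment> \<open>Pays for the one push that \<open>?k - 1\<close> leaves out.\<close>
      moreover have "1 \<le> ?a * (1 / ln 2 * ln (?n + 1))"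
        using mult_mono[OF a one] a by simp
      moreover have "real ?k \<le> real (?k - 1) + 1" by simp
      ultimately have "real ?k \<le> ?a * (1 / ln 2 * ln (?n + 1)) +
          (1 + \<bar>c\<bar> + ln ?D / ln 2) * ln (?n + 1) * (?a * ?D)" by linarith
      also have "\<dots> = space_const c * ?a * ln (?n + 1)"
        unfolding space_const_def by (simp only: distrib_left distrib_right mult_ac)
      finally show ?thesis .
    qed
  qed
qed

text \<open>Every stacked edge has two endpoints, so the stack is no longer than the sum of its
  degrees. The extreme weights are taken over all of \<open>E\<close>, so that the bound applies to
  every prefix of the stream.\<close>

lemma run_length:
  assumes run: "run es S \<phi>" and ratio: "weight_ratio_le V E w c" and E: "set es \<subseteq> E" "finite E"
  shows "real (length S) \<le> space_const c * real (\<Sum>v\<in>V. b v) * ln (real (card V) + 1)"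
proof (cases "\<exists>e\<in>E. w e > 0")
  case True
  let ?W = "Max (w ` E)" and ?P = "{w e | e. e \<in> E \<and> w e > 0}"
  let ?K = "space_const c"
  have P: "finite ?P" "?P \<noteq> {}" using E(2) True by auto
  have "Min ?P \<in> ?P" using P by (rule Min_in)
  then have m: "Min ?P > 0" by auto
  have mle: "Min ?P \<le> w e" if "e \<in> set es" "w e > 0" for e
    using P E(1) that by (intro Min_le) auto
  have Wle: "w e \<le> ?W" if "e \<in> E" for e using E(2) that by simp
  then have W: "?W > 0" using True by (meson less_le_trans)
  have deg: "real (card {e \<in> set S. v \<in> e}) \<le> ?K * real (b v) * ln (real (card V) + 1)"
    if "v \<in> V" for v
    using run_degree[OF run that m mle W, of c] Wle E(1) ratio True
    by (auto simp: weight_ratio_le_def)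
  have S: "distinct S" "\<And>e. e \<in> set S \<Longrightarrow> e \<subseteq> V \<and> card e = 2" using run_stack[OF run] by auto
  have "real (length S) \<le> (\<Sum>e\<in>set S. \<Sum>v\<in>e. 1)" using S by (simp add: distinct_card)
  also have "\<dots> = (\<Sum>v\<in>V. real (card {e \<in> set S. v \<in> e}) * 1)"
    using S(2) by (intro sum_incidences[OF finite_V]) auto
  also have "\<dots> \<le> (\<Sum>v\<in>V. ?K * real (b v) * ln (real (card V) + 1))"
    using deg by (intro sum_mono) simp
  finally show ?thesis by (simp add: sum_distrib_left sum_distrib_right)
next
  case False
  \<comment> \<open>A pushed edge has positive weight, so without positive weights nothing is
    pushed.\<close>
  have "S = []"
    using run E(1) False by induction (auto dest: push_residual(3))
  then show ?thesis using space_const_nonneg by (simp add: sum_nonneg)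
qed

end

section \<open>Transfer to the streaming algorithm\<close>

theorem theorem6p1:
  fixes \<epsilon> c :: real and A :: "('v, 'c) offline_alg"
  assumes "\<epsilon> > 0"
    and "offline_correct A" and "offline_polynomial_time A" and "offline_linear_space A"
  shows "\<exists>(K :: real) (k :: nat). \<forall>(V :: 'v set) E b w es.
    wbm_instance c V E b w es \<longrightarrow>
    (let alg = wbm_streaming (1 + \<epsilon> / 2) 1 A V b;
         stream = map (\<lambda>e. (e, w e)) es
     in
       (\<forall>t \<le> length es.
          stream_memory alg stream t =
            map_pmf (\<lambda>(S, \<phi>). (map (\<lambda>e. (e, w e)) S, \<phi>))
              (msbm (weight w) b (1 + \<epsilon> / 2) 1 es t)) \<and>
       stream_space_le alg stream
         (K * real (\<Sum>v\<in>V. b v) * ln (real (card V) + 1) ^ k) \<and>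
       (\<forall>OPT. max_weight_b_matching V E b w OPT \<longrightarrow>
          (\<forall>M \<in> set_pmf (stream_output alg stream).
             b_matching V E b M \<and> weight w M \<ge> 1 / (3 + \<epsilon>) * weight w OPT)))"
proof -
  let ?C = "1 + \<epsilon> / 2"
  \<comment> \<open>This is \<open>space_const c\<close> written outside the locale: the constant
    must be fixed before the graph, bounds and weights.\<close>
  define D where "D = 1 / ln 2 + ?C / (?C - 1) * (1 + \<bar>c\<bar> + ln (?C / (?C - 1)) / ln 2)"
  from assms(4) obtain K1 :: nat where K1: "\<And>(V :: 'v set) b L i. offline_input V b L \<Longrightarrow>
      i \<le> run_time (off_machine A) (off_load A V b L) \<Longrightarrow>
      m_words (off_machine A) (config (off_machine A) (off_load A V b L) i) \<le> K1 * (card V + length L)"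
    unfolding offline_linear_space_def by blast
  \<comment> \<open>Each stacked edge costs 3 words in memory and \<open>K1\<close> in
    post-processing. The remaining \<open>3 + 3 * n + K1 * n\<close> words are at most
    \<open>(6 + K1) * n\<close>, for \<open>n \<ge> 1\<close> vertices.\<close>
  define K where "K = (3 + real K1) * D + (6 + real K1) / ln 2"
  show ?thesis
  proof (rule exI[of _ K], rule exI[of _ 1], intro allI impI)
    fix V :: "'v set" and E b w es
    assume inst: "wbm_instance c V E b w es"
    then have G: "simple_graph V E" and bpos: "\<forall>v\<in>V. b v > 0" and wn: "\<forall>e\<in>E. w e \<ge> 0"
      and ratio: "weight_ratio_le V E w c" and es: "distinct es" "set es = E"
      by (auto simp: wbm_instance_def)
    have VE: "finite V" "V \<noteq> {}" "\<And>e. e \<in> set es \<Longrightarrow> e \<subseteq> V \<and> card e = 2"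
      using G es by (auto simp: simple_graph_def)
    interpret msbm_linear V b w ?C
      using VE bpos assms(1) by unfold_locales auto
    have D: "space_const c = D" by (simp add: space_const_def D_def)
    let ?alg = "wbm_streaming ?C 1 A V b" and ?stream = "map (\<lambda>e. (e, w e)) es"
    let ?B = "real (\<Sum>v\<in>V. b v) * ln (real (card V) + 1)"
    have run: "\<exists>S \<phi>. run (take t es) S \<phi> \<and>
        msbm (weight w) b ?C 1 es t = return_pmf (S, \<phi>) \<and>
        stream_memory ?alg ?stream t = return_pmf (map (\<lambda>e. (e, w e)) S, \<phi>)"
      if "t \<le> length es" for t
      using msbm_eq_run[OF es(1) VE(3) that] .
    have n: "card V \<ge> 1" using VE by (simp add: Suc_le_eq card_gt_0_iff)
    \<comment> \<open>Positive degree bounds give \<open>n \<le> (\<Sum>v\<in>V. b v)\<close>, so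
      words linear in the number \<open>n\<close> of vertices fit into the space bound.\<close>
    have "(\<Sum>v\<in>V. 1) \<le> (\<Sum>v\<in>V. b v)" using bpos by (intro sum_mono) (auto simp: Suc_le_eq)
    then have sb: "real (card V) \<le> real (\<Sum>v\<in>V. b v)" by (simp del: of_nat_sum)
    have nB: "real (card V) \<le> ?B / ln 2"
    proof -
      have "ln 2 \<le> ln (real (card V) + 1)" using n by simp
      then have "real (card V) * ln 2 \<le> ?B" using sb by (intro mult_mono) auto
      then show ?thesis by (simp add: field_simps)
    qed
    have words: "real (3 * (length S + 1) + 3 * card V + K1 * (card V + length S)) \<le> K * ?B"
      if "run (take t es) S \<phi>" for t S \<phi>
    proof -
      have "set (take t es) \<subseteq> E" using es(2) by (auto dest: in_set_takeD)
      then have "real (length S) \<le> D * ?B"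
        using run_length[OF that ratio] es(2) D by (auto simp: mult_ac)
      then have "(3 + real K1) * real (length S) \<le> (3 + real K1) * (D * ?B)"
        by (intro mult_left_mono) auto
      moreover have "(6 + real K1) * real (card V) \<le> (6 + real K1) * (?B / ln 2)"
        using nB by (intro mult_left_mono) auto
      moreover have "real (card V) \<ge> 1" using n by simp
      ultimately show ?thesis unfolding K_def by (simp add: algebra_simps)
    qed
    obtain S \<phi> where fin: "run es S \<phi>"
        "stream_memory ?alg ?stream (length es) = return_pmf (map (\<lambda>e. (e, w e)) S, \<phi>)"
      using run[of "length es"] by auto
    let ?L = "map (\<lambda>e. (e, w e)) S"
    let ?M = "machine_output (off_machine A) (off_load A V b ?L)"
    have S: "distinct S" "set S \<subseteq> E" using run_stack[OF fin(1)] es by auto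
    have L: "fst ` set ?L = set S" "map fst ?L = S" by (auto simp: comp_def image_image)
    have inp: "offline_input V b ?L"
      unfolding offline_input_def L using S G bpos wn by (auto simp: simple_graph_def)
    then have "max_weight_b_matching V (set S) b (listed_weight ?L) ?M"
      using assms(2) L(1) unfolding offline_correct_def by metis
    \<comment> \<open>The offline algorithm optimises the listed weights; they agree with
      \<open>w\<close> on every subset of the stack, so its result is optimal for \<open>w\<close>
      as well.\<close>
    moreover have "weight (listed_weight ?L) N = weight w N" if "N \<subseteq> set S" for N
      using that by (intro weight_cong) (auto simp: listed_weight_graph)
    ultimately have M: "max_weight_b_matching V (set S) b w ?M"
      by (auto simp: max_weight_b_matching_def is_arg_max_linorder b_matching_def)
    have "\<forall>t \<le> length es. stream_memory ?alg ?stream t =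
        map_pmf (\<lambda>(S, \<phi>). (map (\<lambda>e. (e, w e)) S, \<phi>)) (msbm (weight w) b ?C 1 es t)"
    proof (intro allI impI)
      fix t assume "t \<le> length es"
      from run[OF this] show "stream_memory ?alg ?stream t =
        map_pmf (\<lambda>(S, \<phi>). (map (\<lambda>e. (e, w e)) S, \<phi>)) (msbm (weight w) b ?C 1 es t)"
        by auto
    qed
    moreover have "stream_space_le ?alg ?stream (K * ?B)"
      unfolding stream_space_le_def
    proof (intro conjI allI impI ballI)
      fix t m assume t: "t \<le> length ?stream" and m: "m \<in> set_pmf (stream_memory ?alg ?stream t)"
      from t obtain S' \<phi>' where r: "run (take t es) S' \<phi>'"
        "stream_memory ?alg ?stream t = return_pmf (map (\<lambda>e. (e, w e)) S', \<phi>')"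
        using run[of t] by auto
      then have "real (s_words ?alg m) \<le>
          real (3 * (length S' + 1) + 3 * card V + K1 * (card V + length S'))"
        using m by (simp add: wbm_streaming_def)
      also have "\<dots> \<le> K * ?B" by (rule words[OF r(1)])
      finally show "real (s_words ?alg m) \<le> K * ?B" .
    next
      fix m i assume m: "m \<in> set_pmf (stream_memory ?alg ?stream (length ?stream))"
        and i: "i \<le> run_time (s_post ?alg) (s_load ?alg m)"
      have m': "m = (?L, \<phi>)" using m fin(2) by simp
      have "m_words (off_machine A) (config (off_machine A) (off_load A V b ?L) i)
          \<le> K1 * (card V + length ?L)"
        using i by (intro K1[OF inp]) (simp add: m' wbm_streaming_def)
      then have "real (s_words ?alg m + m_words (s_post ?alg) (config (s_post ?alg) (s_load ?alg m) i))
          \<le> real (3 * (length S + 1) + 3 * card V + K1 * (card V + length S))"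
        unfolding of_nat_le_iff by (simp add: m' wbm_streaming_def)
      also have "\<dots> \<le> K * ?B" using words[of "length es"] fin(1) by simp
      finally show "real (s_words ?alg m +
          m_words (s_post ?alg) (config (s_post ?alg) (s_load ?alg m) i)) \<le> K * ?B" .
    qed
    moreover have "b_matching V E b M \<and> weight w M \<ge> 1 / (3 + \<epsilon>) * weight w OPT"
      if opt: "max_weight_b_matching V E b w OPT" and MM: "M \<in> set_pmf (stream_output ?alg ?stream)"
      for OPT M
    proof -
      have "M = ?M" using MM fin(2) by (simp add: stream_output_def) (simp add: wbm_streaming_def)
      moreover have "b_matching V E b ?M"
        using M S by (auto simp: max_weight_b_matching_def is_arg_max_def b_matching_def)
      \<comment> \<open>For this choice of \<open>?C\<close> the factor \<open>1 + 2 * ?C\<close>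
        equals \<open>3 + \<epsilon>\<close>.\<close>
      moreover have "weight w OPT \<le> (1 + 2 * ?C) * weight w ?M"
        using opt es(2) by (intro run_approx[OF fin(1) M])
          (auto simp: max_weight_b_matching_def is_arg_max_def)
      ultimately show ?thesis using assms(1) by (simp add: field_simps)
    qed
    ultimately show "let alg = ?alg; stream = ?stream in
       (\<forall>t \<le> length es. stream_memory alg stream t =
            map_pmf (\<lambda>(S, \<phi>). (map (\<lambda>e. (e, w e)) S, \<phi>)) (msbm (weight w) b ?C 1 es t)) \<and>
       stream_space_le alg stream (K * real (\<Sum>v\<in>V. b v) * ln (real (card V) + 1) ^ 1) \<and>
       (\<forall>OPT. max_weight_b_matching V E b w OPT \<longrightarrow>
          (\<forall>M \<in> set_pmf (stream_output alg stream).
             b_matching V E b M \<and> weight w M \<ge> 1 / (3 + \<epsilon>) * weight w OPT))"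
      unfolding Let_def by (simp add: mult.assoc)
  qed
qed

end
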